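(* For every finite simple connected graph $G$ it holds that $\gamma_{cg}'(G) \leq 2\,\gamma_{cg}(G)$.
   Context: The connected domination game on a graph $G$ is played by two players, Dominator and Staller, who alternately select vertices. A vertex $w$ is a legal move if (a) its closed neighborhood $N[w]$ contains at least one vertex not in the union of the closed neighborhoods of the previously selected vertices (i.e. it dominates a new vertex), and (b) unless it is the first move, $w$ is adjacent to at least one already selected vertex. The game ends when no legal move exists; on a connected graph the selected vertices then form a connected dominating set. Dominator wants to minimize the total number of moves, Staller wants to maximize it. $\gamma_{cg}(G)$ is the number of moves under optimal play when Dominator moves first (D-game), and $\gamma_{cg}'(G)$ is the number of moves under optimal play when Staller moves first (S-game). *)

theory Defs
  imports "Graph_Theory.Graph_Theory"
begin

datatype player = Dominator | Staller

fun opponent :: "player \<Rightarrow> player" where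
  "opponent Dominator = Staller"
| "opponent Staller = Dominator"

definition closed_nbhd :: "'a pair_pre_digraph \<Rightarrow> 'a \<Rightarrow> 'a set" where
  "closed_nbhd G w = insert w {u. (w, u) \<in> parcs G}"

text \<open>
  Legality of a move depends only on the set \<open>S\<close> of vertices selected so far, not on their order
  or on the player. \<open>S = {}\<close> exactly when the first move is to be made.
\<close>
definition legal_moves :: "'a pair_pre_digraph \<Rightarrow> 'a set \<Rightarrow> 'a set" where
  "legal_moves G S = {w \<in> pverts G.
     \<not> closed_nbhd G w \<subseteq> (\<Union>v\<in>S. closed_nbhd G v) \<and>
     (S \<noteq> {} \<longrightarrow> (\<exists>v\<in>S. (v, w) \<in> parcs G))}"

lemma legal_moves_subset: "legal_moves G S \<subseteq> pverts G - S"
  by (auto simp: legal_moves_def)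

text \<open>
  \<open>moves_left G p S\<close> is the number of further moves under optimal play when the vertices in \<open>S\<close>
  have been selected and it is \<open>p\<close>'s turn. The test \<open>finite (pverts G)\<close> only serves to make the
  recursion terminate; it holds in every \<^const>\<open>pair_graph\<close>.
\<close>
function moves_left :: "'a pair_pre_digraph \<Rightarrow> player \<Rightarrow> 'a set \<Rightarrow> nat" where
  "moves_left G p S =
     (if finite (pverts G) \<and> legal_moves G S \<noteq> {}
      then 1 + (case p of Dominator \<Rightarrow> Min | Staller \<Rightarrow> Max)
                 ((\<lambda>w. moves_left G (opponent p) (insert w S)) ` legal_moves G S)
      else 0)"
  by pat_completeness auto
termination
proof (relation "measure (\<lambda>(G, p, S). card (pverts G - S))", goal_cases)
  case 1
  show ?case by simp
next
  case (2 G p S w)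
  then have "w \<in> pverts G - S"
    using legal_moves_subset[of G S] by auto
  then have "pverts G - insert w S \<subset> pverts G - S"
    by blast
  with 2 show ?case
    by (simp add: psubset_card_mono)
qed

declare moves_left.simps [simp del]

definition gamma_cg :: "'a pair_pre_digraph \<Rightarrow> nat" where
  "gamma_cg G = moves_left G Dominator {}"

definition gamma_cg' :: "'a pair_pre_digraph \<Rightarrow> nat" where
  "gamma_cg' G = moves_left G Staller {}"

end

theory Submission
  imports Defs
begin

text \<open>
  Let \<open>D\<close> be a connected dominating set. Once some vertex has been selected, Dominator can always
  answer inside \<open>D\<close>: either some dominated vertex of \<open>D\<close> has an undominated neighbour in \<open>D\<close>, or
  all of \<open>D\<close> is dominated and the vertex of \<open>D\<close> that dominates an undominated vertex is legal. So
  Dominator makes at most \<open>card D\<close> moves and the Staller-start game lasts at most \<open>2 * card D\<close>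
  moves. The vertices selected in an optimally played Dominator-start game form such a \<open>D\<close>.
\<close>

definition dominated :: "'a pair_pre_digraph \<Rightarrow> 'a set \<Rightarrow> 'a set" where
  "dominated G S = (\<Union>v\<in>S. closed_nbhd G v)"

text \<open>Connectivity of the subgraph induced by \<open>D\<close>, stated by cuts.\<close>
definition cut_connected :: "'a pair_pre_digraph \<Rightarrow> 'a set \<Rightarrow> bool" where
  "cut_connected G D \<longleftrightarrow>
     (\<forall>A \<subset> D. A \<noteq> {} \<longrightarrow> (\<exists>a\<in>A. \<exists>b\<in>D - A. (a, b) \<in> parcs G))"

lemma cut_connectedE:
  assumes "cut_connected G D" "A \<subset> D" "A \<noteq> {}"
  obtains a b where "a \<in> A" "b \<in> D - A" "(a, b) \<in> parcs G"
  using assms unfolding cut_connected_def by blast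

lemma legal_moves_iff:
  "w \<in> legal_moves G S \<longleftrightarrow> w \<in> pverts G \<and> \<not> closed_nbhd G w \<subseteq> dominated G S \<and>
     (S \<noteq> {} \<longrightarrow> (\<exists>v\<in>S. (v, w) \<in> parcs G))"
  by (simp add: legal_moves_def dominated_def)

lemma mem_dominated_iff: "v \<in> dominated G S \<longleftrightarrow> v \<in> S \<or> (\<exists>u\<in>S. (u, v) \<in> parcs G)"
  by (auto simp: dominated_def closed_nbhd_def)

text \<open>If \<open>w\<close> were in \<open>S\<close>, its closed neighbourhood would already be
  dominated. So \<open>w\<close> is dominated but not selected, hence has a selected neighbour, and
  the adjacency rule is satisfied.\<close>

lemma mem_legal_movesI:
  assumes "w \<in> pverts G" "w \<in> dominated G S" "v \<in> closed_nbhd G w" "v \<notin> dominated G S"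
  shows "w \<in> legal_moves G S"
proof -
  have "w \<notin> S"
    using assms(3,4) by (auto simp: dominated_def)
  then show ?thesis
    using assms by (auto simp: legal_moves_iff mem_dominated_iff)
qed

lemma moves_left_eq_0: "legal_moves G S = {} \<Longrightarrow> moves_left G p S = 0"
  by (subst moves_left.simps) simp

context pair_graph
begin

lemma parcs_sym: "(u, v) \<in> parcs G \<Longrightarrow> (v, u) \<in> parcs G"
  using arcs_symmetric by simp

lemma finite_legal_moves: "finite (legal_moves G S)"
  by (rule finite_subset[OF _ finite_verts]) (auto simp: legal_moves_def)

text \<open>Both \<open>Min\<close> and \<open>Max\<close> are attained on a finite nonempty set, so
  an optimal play can be followed move by move without distinguishing the players.\<close>

lemma moves_left_opponent:
  assumes "legal_moves G S \<noteq> {}"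
  obtains w where "w \<in> legal_moves G S"
    and "moves_left G p S = Suc (moves_left G (opponent p) (insert w S))"
proof -
  let ?M = "(\<lambda>w. moves_left G (opponent p) (insert w S)) ` legal_moves G S"
  have "finite ?M" "?M \<noteq> {}"
    using assms finite_legal_moves by auto
  from Min_in[OF this] Max_in[OF this]
  have "(case p of Dominator \<Rightarrow> Min | Staller \<Rightarrow> Max) ?M \<in> ?M"
    by (cases p) (simp_all only: player.case)
  moreover have "moves_left G p S = Suc ((case p of Dominator \<Rightarrow> Min | Staller \<Rightarrow> Max) ?M)"
    using assms finite_verts by (subst moves_left.simps) simp
  ultimately show ?thesis
    using that by auto
qed

lemma moves_left_Dominator_le:
  assumes "w \<in> legal_moves G S"
  shows "moves_left G Dominator S \<le> Suc (moves_left G Staller (insert w S))"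
proof -
  have "moves_left G Dominator S =
      Suc (Min ((\<lambda>w. moves_left G Staller (insert w S)) ` legal_moves G S))"
    using assms finite_verts by (subst moves_left.simps) auto
  then show ?thesis
    using assms finite_legal_moves by simp
qed

lemma cut_connected_insert:
  assumes D: "cut_connected G D" and v: "v \<in> D" "(v, w) \<in> parcs G"
  shows "cut_connected G (insert w D)"
  unfolding cut_connected_def
proof (intro allI impI)
  fix A assume A: "A \<subset> insert w D" "A \<noteq> {}"
  \<comment> \<open>In the outer cases the cut separates \<open>w\<close> from all of
    \<open>D\<close>, and the edge between \<open>v\<close> and \<open>w\<close> crosses it; in the
    middle case a crossing edge exists inside \<open>D\<close>.\<close>
  consider "A \<inter> D = {}" | "A \<inter> D \<noteq> {}" "A \<inter> D \<subset> D" | "D \<subseteq> A"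
    by blast
  then show "\<exists>a\<in>A. \<exists>b\<in>insert w D - A. (a, b) \<in> parcs G"
  proof cases
    case 1
    then have "A = {w}" using A by blast
    then show ?thesis
      using 1 v parcs_sym by blast
  next
    case 2
    from cut_connectedE[OF D 2(2,1)] show ?thesis by blast
  next
    case 3
    then show ?thesis using A v by blast
  qed
qed

lemma cut_connected_pverts:
  assumes "connected G"
  shows "cut_connected G (pverts G)"
  unfolding cut_connected_def
proof (intro allI impI)
  fix A assume A: "A \<subset> pverts G" "A \<noteq> {}"
  then obtain u v where uv: "u \<in> A" "v \<in> pverts G" "v \<notin> A" by blast
  moreover have "strongly_connected G"
    using sym_arcs assms by (rule symmetric_connected_imp_strongly_connected)
  ultimately have "u \<rightarrow>\<^sup>*\<^bsub>with_proj G\<^esub> v"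
    using A by (auto simp: strongly_connected_def)
  \<comment> \<open>Along a walk starting in \<open>A\<close>, either the current endpoint is still
    in \<open>A\<close> or some arc has already left \<open>A\<close>.\<close>
  then have "v \<in> A \<or> (\<exists>a\<in>A. \<exists>b\<in>pverts G - A. (a, b) \<in> parcs G)"
  proof (induction rule: reachable_induct)
    case base
    then show ?case using uv by simp
  next
    case (step x y)
    then have "(x, y) \<in> parcs G" "y \<in> pverts G"
      using in_arcsD2 by auto
    with step.IH show ?case by blast
  qed
  then show "\<exists>a\<in>A. \<exists>b\<in>pverts G - A. (a, b) \<in> parcs G"
    using uv by simp
qed

lemma legal_move_in_connected_dominating:
  assumes D: "D \<subseteq> pverts G" "cut_connected G D" "pverts G \<subseteq> dominated G D"
    and S: "S \<noteq> {}" "S \<subseteq> pverts G" and undom: "\<not> pverts G \<subseteq> dominated G S"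
  shows "D \<inter> legal_moves G S \<noteq> {}"
proof (cases "D \<subseteq> dominated G S")
  case True
  from undom obtain v where "v \<in> pverts G" "v \<notin> dominated G S" by blast
  moreover from this obtain d where "d \<in> D" "v \<in> closed_nbhd G d"
    using D(3) by (auto simp: dominated_def)
  ultimately have "d \<in> legal_moves G S"
    using True D(1) by (intro mem_legal_movesI) auto
  with \<open>d \<in> D\<close> show ?thesis by blast
next
  case False
  obtain s where "s \<in> S" using S by blast
  then have "s \<in> dominated G D" using S D(3) by blast
  \<comment> \<open>The selected vertex \<open>s\<close> lies in \<open>D\<close> or has a neighbour
    in \<open>D\<close>; either way this gives a vertex of \<open>D\<close> dominated by
    \<open>s\<close>. The cut of \<open>D\<close> into its dominated and undominated part is then
    proper.\<close>
  then have "D \<inter> dominated G S \<noteq> {}"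
    using \<open>s \<in> S\<close> parcs_sym unfolding disjoint_iff mem_dominated_iff by blast
  with D(2) False obtain a b where
    "a \<in> D \<inter> dominated G S" "b \<in> D - D \<inter> dominated G S" "(a, b) \<in> parcs G"
    by (elim cut_connectedE[of G D "D \<inter> dominated G S"]) auto
  then have "a \<in> legal_moves G S"
    using D(1) by (intro mem_legal_movesI[of _ _ _ b]) (auto simp: closed_nbhd_def)
  with \<open>a \<in> D \<inter> _\<close> show ?thesis by blast
qed

lemma legal_moves_empty_if_dominating:
  "pverts G \<subseteq> dominated G S \<Longrightarrow> legal_moves G S = {}"
  using in_arcsD2 by (fastforce simp: legal_moves_def closed_nbhd_def dominated_def)

text \<open>Each answer of Dominator inside \<open>D\<close> lowers \<open>card (D - S)\<close> by
  one and pays for two moves; on Dominator's turn Staller's half of the pair is already spent, hence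
  the 1 subtracted. The induction runs over all unselected vertices because Staller may play outside
  \<open>D\<close>.\<close>

lemma moves_left_le_connected_dominating:
  assumes D: "D \<subseteq> pverts G" "cut_connected G D" "pverts G \<subseteq> dominated G D"
  shows "S \<subseteq> pverts G \<Longrightarrow> p = Staller \<or> S \<noteq> {} \<Longrightarrow>
    moves_left G p S \<le> 2 * card (D - S) - (if p = Dominator then 1 else 0)"
proof (induction "card (pverts G - S)" arbitrary: p S rule: less_induct)
  case less
  have finD: "finite D" using D(1) finite_verts by (rule finite_subset)
  show ?case
  proof (cases "legal_moves G S = {}")
    case True
    then show ?thesis by (simp add: moves_left_eq_0)
  next
    case False
    then have undom: "\<not> pverts G \<subseteq> dominated G S"
      using legal_moves_empty_if_dominating by blast
    then have "\<not> D \<subseteq> S"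
      using D(3) unfolding dominated_def by blast
    \<comment> \<open>Needed on Staller's turn: the bound after the move is a truncated subtraction,
      which loses the 1 if no vertex of \<open>D\<close> remains.\<close>
    then have pos: "card (D - S) > 0"
      using finD by (simp add: card_gt_0_iff)
    have IH: "moves_left G (opponent p) (insert w S) \<le>
        2 * card (D - insert w S) - (if opponent p = Dominator then 1 else 0)"
      if "w \<in> legal_moves G S" for w
    proof (rule less.hyps)
      have w: "w \<in> pverts G - S" using that legal_moves_subset[of G S] by blast
      show "card (pverts G - insert w S) < card (pverts G - S)"
        using w finite_verts by (intro psubset_card_mono) auto
      show "insert w S \<subseteq> pverts G" using w less.prems by blast
    qed simp
    show ?thesis
    proof (cases p)
      case Dominator
      with less.prems have "S \<noteq> {}" by simp
      from legal_move_in_connected_dominating[OF D this less.prems(1) undom]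
      obtain d where d: "d \<in> D" "d \<in> legal_moves G S" by blast
      then have "d \<in> D - S" using legal_moves_subset[of G S] by blast
      then have "card (D - S) = Suc (card (D - insert d S))"
        using finD by (metis Diff_insert card_Suc_Diff1 finite_Diff)
      then show ?thesis
        using moves_left_Dominator_le[OF d(2)] IH[OF d(2)] Dominator by simp
    next
      case Staller
      obtain w where w: "w \<in> legal_moves G S"
        "moves_left G p S = Suc (moves_left G (opponent p) (insert w S))"
        using moves_left_opponent[OF False] .
      have "card (D - insert w S) \<le> card (D - S)"
        using finD by (intro card_mono) auto
      then show ?thesis
        using w(2) IH[OF w(1)] pos Staller by simp
    qed
  qed
qed

text \<open>\<open>D\<close> is the set selected at the end of an optimal play continuing from
  \<open>S\<close>: the adjacency rule keeps the selected set connected, and each move adds one new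
  vertex.\<close>

lemma connected_dominating_after_play:
  assumes "connected G"
  shows "S \<subseteq> pverts G \<Longrightarrow> cut_connected G S \<Longrightarrow>
    \<exists>D \<subseteq> pverts G. cut_connected G D \<and> pverts G \<subseteq> dominated G D \<and>
      card D \<le> card S + moves_left G p S"
proof (induction "card (pverts G - S)" arbitrary: p S rule: less_induct)
  case less
  show ?case
  proof (cases "legal_moves G S = {}")
    case True
    have "pverts G \<subseteq> dominated G S"
    proof (cases "S = {}")
      case True
      with \<open>legal_moves G S = {}\<close> show ?thesis
        by (auto simp: legal_moves_iff closed_nbhd_def dominated_def)
    next
      case False
      \<comment> \<open>The whole vertex set serves as the connected dominating set here: a nonempty
        \<open>S\<close> that is not dominating would still leave a legal move.\<close>
      have "pverts G \<subseteq> dominated G (pverts G)"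
        by (auto simp: mem_dominated_iff)
      with True False show ?thesis
        using legal_move_in_connected_dominating[OF subset_refl cut_connected_pverts[OF assms]]
          less.prems(1) by blast
    qed
    with less.prems show ?thesis by (intro exI[of _ S]) auto
  next
    case False
    obtain w where w: "w \<in> legal_moves G S"
      "moves_left G p S = Suc (moves_left G (opponent p) (insert w S))"
      using moves_left_opponent[OF False] .
    from w(1) have wS: "w \<in> pverts G - S" using legal_moves_subset[of G S] by blast
    have "cut_connected G (insert w S)"
    proof (cases "S = {}")
      case True
      then show ?thesis by (auto simp: cut_connected_def)
    next
      case False
      with w(1) obtain v where "v \<in> S" "(v, w) \<in> parcs G"
        unfolding legal_moves_iff by blast
      with less.prems(2) show ?thesis by (rule cut_connected_insert)
    qed
    moreover have "card (pverts G - insert w S) < card (pverts G - S)"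
      using wS finite_verts by (intro psubset_card_mono) auto
    moreover have "card (insert w S) = Suc (card S)"
      using wS less.prems(1) finite_subset[OF _ finite_verts] by simp
    ultimately show ?thesis
      using less.hyps[of "insert w S" "opponent p"] wS less.prems(1) w(2) by simp
  qed
qed

end

theorem theorem3p2:
  fixes G :: "'a pair_pre_digraph"
  assumes "pair_graph G" and "connected G"
  shows "gamma_cg' G \<le> 2 * gamma_cg G"
proof -
  interpret pair_graph G by fact
  obtain D where D: "D \<subseteq> pverts G" "cut_connected G D" "pverts G \<subseteq> dominated G D"
    and "card D \<le> gamma_cg G"
    using connected_dominating_after_play[OF assms(2), of "{}" Dominator]
    by (auto simp: gamma_cg_def cut_connected_def)
  moreover have "gamma_cg' G \<le> 2 * card D"
    using moves_left_le_connected_dominating[OF D, of "{}" Staller] by (simp add: gamma_cg'_def)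
  ultimately show ?thesis by linarith
qed

end
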